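(* Let $G$ be a finite group and let $T$ be a regular trisp that is an abstract simplicial complex (different simplices have different vertex sets), with $G$ acting on $T$ so that Condition R holds. Let $\psi:\bar B\to\bar R$ be a trisp closure map on $T/G$, and put $B=\{b\in X : X\in\bar B\}$ and $R=\{r\in X : X\in\bar R\}$. Then the following are equivalent: (1) $\psi$ fulfills Condition C: for each $b\in B$ there is a unique vertex $r_b\in\psi(Gb)$ such that there exists a simplex of $T$ with vertex set $\{b,r_b\}$, and this simplex is unique as well. (2) The assignment $\phi:B\to R$, $\phi(b)=r_b$, with $r_b$ as in Condition C, is (well-defined and) a trisp closure map on $T$ with $\phi_G=\psi$, i.e. $G\phi(b)=\psi(Gb)$ for all $b\in B$.
   Context: A trisp (triangulated space, $\Delta$-complex, semisimplicial set) $T$ consists of sets $S_n(T)$, $n\ge 0$, of $n$-simplices together with boundary maps $\partial_i:S_n(T)\to S_{n-1}(T)$, $0\le i\le n$, satisfying $\partial_i\partial_j=\partial_{j-1}\partial_i$ for $i<j$. Vertices are the $0$-simplices; every $n$-simplex has an ordered list of vertices $v_0,\dots,v_n$, and "minimal" refers to this order. The faces (boundary simplices) of $\sigma$ are those obtained by iterated boundary maps. $T$ is regular if each $n$-simplex has $n+1$ distinct vertices. A $G$-action on $T$ is an action on the sets of simplices commuting with all boundary maps. Condition R: for any $g\in G$ and any simplex $\sigma$ of $T$, $g(\sigma)\cap\sigma$ is fixed pointwise by $g$, i.e. every simplex that is a face of both $\sigma$ and $g\sigma$ (each simplex counting as a face of itself) is fixed by $g$. The quotient $T/G$ is the trisp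 whose simplices are the orbits $G\sigma$, with $\partial_i(G\sigma)=G(\partial_i\sigma)$; Condition R guarantees that it is regular. In particular vertices of $T/G$ are orbits of vertices of $T$. A trisp closure map on a regular trisp $T$ is a partition of the vertex set into blue vertices $B$ and red vertices $R$, together with a map $\phi:B\to R$ such that for every simplex $\sigma$ of $T$ containing at least one blue vertex, with $b$ its minimal blue vertex, one of the following holds: either $\phi(b)$ is a vertex of $\sigma$, and removing $\phi(b)$ from $\sigma$ yields another (unique) simplex of $T$; or $\phi(b)$ is not a vertex of $\sigma$, and there exists a unique simplex $\tau$ of $T$ that contains $\phi(b)$ as a vertex and $\sigma$ as a boundary simplex of codimension $1$. *)

theory Defs
  imports "HOL-Algebra.Group_Action"
begin

section \<open>Trisps\<close>

text \<open>
  \<open>simps T n\<close> is the set of \<open>n\<close>-simplices and \<open>bdry T n i\<close> the boundary map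
  from \<open>n\<close>-simplices to \<open>(n - 1)\<close>-simplices; it is only meaningful for \<open>n > 0\<close> and
  \<open>i \<le> n\<close>. The sets \<open>simps T n\<close> need not be disjoint for different \<open>n\<close>, so a
  simplex of \<open>T\<close> in unspecified dimension is a pair of a dimension and an element
  (see \<open>splx\<close> below). Vertices are the elements of \<open>simps T 0\<close>.
\<close>

record 'a trisp =
  simps :: "nat \<Rightarrow> 'a set"
  bdry :: "nat \<Rightarrow> nat \<Rightarrow> 'a \<Rightarrow> 'a"

definition is_trisp :: "'a trisp \<Rightarrow> bool" where
  "is_trisp T \<longleftrightarrow>
     (\<forall>n. \<forall>i \<le> Suc n. \<forall>x \<in> simps T (Suc n). bdry T (Suc n) i x \<in> simps T n) \<and>
     (\<forall>n. \<forall>x \<in> simps T (Suc (Suc n)). \<forall>i j. i < j \<and> j \<le> Suc (Suc n) \<longrightarrow>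
        bdry T (Suc n) i (bdry T (Suc (Suc n)) j x) =
        bdry T (Suc n) (j - 1) (bdry T (Suc (Suc n)) i x))"

definition splx :: "'a trisp \<Rightarrow> (nat \<times> 'a) set" where
  "splx T = (SIGMA n:UNIV. simps T n)"

text \<open>
  \<open>vert T n x k\<close> is the vertex \<open>v\<^sub>k\<close> of the \<open>n\<close>-simplex \<open>x\<close>, for \<open>k \<le> n\<close>. Removing the
  last vertex (the boundary map of index \<open>n\<close>) keeps \<open>v\<^sub>0, \<dots>, v\<^sub>n\<^sub>-\<^sub>1\<close>; the last vertex is
  reached by removing the first one repeatedly. By the lemma \<open>vert_bdry\<close> below the
  order in which the other vertices are removed does not matter.
\<close>

fun vert :: "'a trisp \<Rightarrow> nat \<Rightarrow> 'a \<Rightarrow> nat \<Rightarrow> 'a" where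
  "vert T 0 x k = x"
| "vert T (Suc n) x k =
     (if k \<le> n then vert T n (bdry T (Suc n) (Suc n) x) k
      else vert T n (bdry T (Suc n) 0 x) n)"

definition vset :: "'a trisp \<Rightarrow> nat \<times> 'a \<Rightarrow> 'a set" where
  "vset T s = vert T (fst s) (snd s) ` {..fst s}"

definition is_facet :: "'a trisp \<Rightarrow> nat \<times> 'a \<Rightarrow> nat \<times> 'a \<Rightarrow> bool" where
  "is_facet T t s \<longleftrightarrow>
     fst s = Suc (fst t) \<and> (\<exists>i \<le> fst s. snd t = bdry T (fst s) i (snd s))"

abbreviation is_face :: "'a trisp \<Rightarrow> nat \<times> 'a \<Rightarrow> nat \<times> 'a \<Rightarrow> bool" where
  "is_face T \<equiv> (is_facet T)\<^sup>*\<^sup>*"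

definition regular_trisp :: "'a trisp \<Rightarrow> bool" where
  "regular_trisp T \<longleftrightarrow>
     is_trisp T \<and> (\<forall>n. \<forall>x \<in> simps T n. inj_on (vert T n x) {..n})"

definition abstract_complex :: "'a trisp \<Rightarrow> bool" where
  "abstract_complex T \<longleftrightarrow> inj_on (vset T) (splx T)"


section \<open>Group actions and quotients\<close>

definition trisp_action ::
    "('g, 'm) monoid_scheme \<Rightarrow> 'a trisp \<Rightarrow> (nat \<Rightarrow> 'g \<Rightarrow> 'a \<Rightarrow> 'a) \<Rightarrow> bool" where
  "trisp_action G T act \<longleftrightarrow>
     (\<forall>n. group_action G (simps T n) (act n)) \<and>
     (\<forall>g \<in> carrier G. \<forall>n. \<forall>i \<le> Suc n. \<forall>x \<in> simps T (Suc n).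
        act n g (bdry T (Suc n) i x) = bdry T (Suc n) i (act (Suc n) g x))"

definition condition_R ::
    "('g, 'm) monoid_scheme \<Rightarrow> 'a trisp \<Rightarrow> (nat \<Rightarrow> 'g \<Rightarrow> 'a \<Rightarrow> 'a) \<Rightarrow> bool" where
  "condition_R G T act \<longleftrightarrow>
     (\<forall>g \<in> carrier G. \<forall>(n, x) \<in> splx T. \<forall>(m, y) \<in> splx T.
        is_face T (m, y) (n, x) \<and> is_face T (m, y) (n, act n g x) \<longrightarrow> act m g y = y)"

text \<open>
  The boundary maps of the quotient are images of orbits; the lemma \<open>bdry_quotient\<close>
  below says that they send the orbit of a simplex to the orbit of its boundary.
\<close>

definition quotient_trisp ::
    "('g, 'm) monoid_scheme \<Rightarrow> 'a trisp \<Rightarrow> (nat \<Rightarrow> 'g \<Rightarrow> 'a \<Rightarrow> 'a) \<Rightarrow> 'a set trisp" where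
  "quotient_trisp G T act =
     \<lparr>simps = (\<lambda>n. orbits G (simps T n) (act n)), bdry = (\<lambda>n i X. bdry T n i ` X)\<rparr>"


section \<open>Trisp closure maps\<close>

definition min_blue :: "'a trisp \<Rightarrow> 'a set \<Rightarrow> nat \<times> 'a \<Rightarrow> 'a \<Rightarrow> bool" where
  "min_blue T B s b \<longleftrightarrow>
     (\<exists>k \<le> fst s. b = vert T (fst s) (snd s) k \<and> b \<in> B \<and>
        (\<forall>j < k. vert T (fst s) (snd s) j \<notin> B))"

definition trisp_closure_map :: "'a trisp \<Rightarrow> 'a set \<Rightarrow> 'a set \<Rightarrow> ('a \<Rightarrow> 'a) \<Rightarrow> bool" where
  "trisp_closure_map T B R \<phi> \<longleftrightarrow>
     regular_trisp T \<and> B \<union> R = simps T 0 \<and> B \<inter> R = {} \<and> \<phi> \<in> B \<rightarrow> R \<and>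
     (\<forall>s \<in> splx T. \<forall>b. min_blue T B s b \<longrightarrow>
        (\<phi> b \<in> vset T s \<and>
           (\<exists>!t. t \<in> splx T \<and> is_facet T t s \<and> vset T t = vset T s - {\<phi> b})) \<or>
        (\<phi> b \<notin> vset T s \<and>
           (\<exists>!t. t \<in> splx T \<and> \<phi> b \<in> vset T t \<and> is_facet T s t)))"


section \<open>Condition C\<close>

definition C_candidate ::
    "('g, 'm) monoid_scheme \<Rightarrow> 'a trisp \<Rightarrow> (nat \<Rightarrow> 'g \<Rightarrow> 'a \<Rightarrow> 'a) \<Rightarrow>
     ('a set \<Rightarrow> 'a set) \<Rightarrow> 'a \<Rightarrow> 'a \<Rightarrow> bool" where
  "C_candidate G T act \<psi> b r \<longleftrightarrow>
     r \<in> \<psi> (orbit G (act 0) b) \<and> (\<exists>s \<in> splx T. vset T s = {b, r})"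

text \<open>The vertex \<open>r\<^sub>b\<close>; unspecified unless there is exactly one candidate.\<close>

definition C_vertex ::
    "('g, 'm) monoid_scheme \<Rightarrow> 'a trisp \<Rightarrow> (nat \<Rightarrow> 'g \<Rightarrow> 'a \<Rightarrow> 'a) \<Rightarrow>
     ('a set \<Rightarrow> 'a set) \<Rightarrow> 'a \<Rightarrow> 'a" where
  "C_vertex G T act \<psi> b = (THE r. C_candidate G T act \<psi> b r)"

definition condition_C ::
    "('g, 'm) monoid_scheme \<Rightarrow> 'a trisp \<Rightarrow> (nat \<Rightarrow> 'g \<Rightarrow> 'a \<Rightarrow> 'a) \<Rightarrow>
     'a set \<Rightarrow> ('a set \<Rightarrow> 'a set) \<Rightarrow> bool" where
  "condition_C G T act B \<psi> \<longleftrightarrow>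
     (\<forall>b \<in> B. (\<exists>!r. C_candidate G T act \<psi> b r) \<and>
        (\<exists>!s. s \<in> splx T \<and> vset T s = {b, C_vertex G T act \<psi> b}))"


section \<open>Adequacy of the definitions\<close>

lemma bdry_in:
  "is_trisp T \<Longrightarrow> x \<in> simps T (Suc n) \<Longrightarrow> i \<le> Suc n \<Longrightarrow> bdry T (Suc n) i x \<in> simps T n"
  by (auto simp: is_trisp_def)

lemma bdry_bdry:
  assumes "is_trisp T" "x \<in> simps T (Suc (Suc n))" "i < j" "j \<le> Suc (Suc n)"
  shows "bdry T (Suc n) i (bdry T (Suc (Suc n)) j x) =
         bdry T (Suc n) (j - 1) (bdry T (Suc (Suc n)) i x)"
  using assms by (auto simp: is_trisp_def)

lemma vert_in:
  "is_trisp T \<Longrightarrow> x \<in> simps T n \<Longrightarrow> vert T n x k \<in> simps T 0"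
  by (induction n arbitrary: x k) (auto simp: bdry_in)

text \<open>The vertices of \<open>bdry T n i x\<close> are those of \<open>x\<close>, in the same order, without \<open>v\<^sub>i\<close>.\<close>

lemma vert_bdry:
  assumes "is_trisp T" "x \<in> simps T (Suc n)" "i \<le> Suc n" "k \<le> n"
  shows "vert T n (bdry T (Suc n) i x) k = vert T (Suc n) x (if k < i then k else Suc k)"
  using assms(2-)
proof (induction n arbitrary: x i k)
  case 0
  then have "i = 0 \<or> i = 1" by auto
  with 0 show ?case by auto
next
  case (Suc n)
  have mem: "bdry T (Suc (Suc n)) j x \<in> simps T (Suc n)" if "j \<le> Suc (Suc n)" for j
    using that Suc.prems bdry_in[OF assms(1)] by blast
  show ?case
  proof (cases "i = Suc (Suc n)")
    case True
    then show ?thesis using Suc.prems by auto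
  next
    case False
    then have i: "i \<le> Suc n" using Suc.prems by simp
    show ?thesis
    proof (cases "k \<le> n")
      case True
      have "bdry T (Suc n) (Suc n) (bdry T (Suc (Suc n)) i x) =
            bdry T (Suc n) i (bdry T (Suc (Suc n)) (Suc (Suc n)) x)"
        using bdry_bdry[OF assms(1) Suc.prems(1), of i "Suc (Suc n)"] i by simp
      then have "vert T (Suc n) (bdry T (Suc (Suc n)) i x) k =
          vert T n (bdry T (Suc n) i (bdry T (Suc (Suc n)) (Suc (Suc n)) x)) k"
        using True by simp
      also have "\<dots> = vert T (Suc n) (bdry T (Suc (Suc n)) (Suc (Suc n)) x)
          (if k < i then k else Suc k)"
        by (rule Suc.IH) (use mem i True in auto)
      finally show ?thesis using True
        by (simp only: vert.simps(2)[of T "Suc n"]) auto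
    next
      case False
      then have k: "k = Suc n" using Suc.prems by simp
      show ?thesis
      proof (cases "i = 0")
        case True
        then show ?thesis using k by simp
      next
        case False
        then have "bdry T (Suc n) 0 (bdry T (Suc (Suc n)) i x) =
            bdry T (Suc n) (i - 1) (bdry T (Suc (Suc n)) 0 x)"
          using bdry_bdry[OF assms(1) Suc.prems(1), of 0 i] i by simp
        then have "vert T (Suc n) (bdry T (Suc (Suc n)) i x) k =
            vert T n (bdry T (Suc n) (i - 1) (bdry T (Suc (Suc n)) 0 x)) n"
          using k by simp
        also have "\<dots> = vert T (Suc n) (bdry T (Suc (Suc n)) 0 x)
            (if n < i - 1 then n else Suc n)"
          by (rule Suc.IH) (use mem i in auto)
        finally show ?thesis using k i False
          by (simp only: vert.simps(2)[of T "Suc n"]) auto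
      qed
    qed
  qed
qed

lemma vert_is_face:
  assumes "is_trisp T" "x \<in> simps T n" "k \<le> n"
  shows "is_face T (0, vert T n x k) (n, x)"
  using assms(2-)
proof (induction n arbitrary: x k)
  case 0
  then show ?case by simp
next
  case (Suc n)
  have step: "is_face T (0, vert T n (bdry T (Suc n) i x) j) (Suc n, x)"
    if "i \<le> Suc n" "j \<le> n" for i j
  proof -
    have "is_face T (0, vert T n (bdry T (Suc n) i x) j) (n, bdry T (Suc n) i x)"
      using Suc that bdry_in[OF assms(1)] by blast
    moreover have "is_facet T (n, bdry T (Suc n) i x) (Suc n, x)"
      using that by (auto simp: is_facet_def)
    ultimately show ?thesis by (rule rtranclp.rtrancl_into_rtrancl)
  qed
  show ?case using step[of "Suc n" k] step[of 0 n] by auto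
qed

context
  fixes G :: "('g, 'm) monoid_scheme" and T :: "'a trisp" and act
  assumes T: "is_trisp T" and A: "trisp_action G T act"
begin

lemma act_in: "g \<in> carrier G \<Longrightarrow> x \<in> simps T n \<Longrightarrow> act n g x \<in> simps T n"
  using A group_action.element_image unfolding trisp_action_def by fastforce

lemma act_bdry:
  "g \<in> carrier G \<Longrightarrow> x \<in> simps T (Suc n) \<Longrightarrow> i \<le> Suc n \<Longrightarrow>
   act n g (bdry T (Suc n) i x) = bdry T (Suc n) i (act (Suc n) g x)"
  using A by (auto simp: trisp_action_def)

lemma act_vert:
  "g \<in> carrier G \<Longrightarrow> x \<in> simps T n \<Longrightarrow> act 0 g (vert T n x k) = vert T n (act n g x) k"
  by (induction n arbitrary: x k) (auto simp: bdry_in[OF T] act_bdry)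

lemma bdry_quotient:
  assumes "x \<in> simps T (Suc n)" "i \<le> Suc n"
  shows "bdry (quotient_trisp G T act) (Suc n) i (orbit G (act (Suc n)) x) =
         orbit G (act n) (bdry T (Suc n) i x)"
proof -
  have "orbit G (act n) (bdry T (Suc n) i x) =
      {bdry T (Suc n) i (act (Suc n) g x) | g. g \<in> carrier G}"
    unfolding orbit_def using act_bdry[OF _ assms] by (metis (no_types, lifting))
  then show ?thesis by (auto simp: quotient_trisp_def orbit_def)
qed

lemma simps_quotient:
  "simps (quotient_trisp G T act) n = orbit G (act n) ` simps T n"
  by (auto simp: quotient_trisp_def orbits_def)

lemma is_trisp_quotient: "is_trisp (quotient_trisp G T act)"
  unfolding is_trisp_def simps_quotient
proof (intro conjI allI impI ballI)
  fix n i X assume "i \<le> Suc n" "X \<in> orbit G (act (Suc n)) ` simps T (Suc n)"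
  then show "bdry (quotient_trisp G T act) (Suc n) i X \<in> orbit G (act n) ` simps T n"
    by (auto simp: bdry_quotient bdry_in[OF T])
next
  fix n X i j
  assume X: "X \<in> orbit G (act (Suc (Suc n))) ` simps T (Suc (Suc n))"
    and ij: "i < j \<and> j \<le> Suc (Suc n)"
  then obtain x where x: "x \<in> simps T (Suc (Suc n))" "X = orbit G (act (Suc (Suc n))) x"
    by blast
  have le: "i \<le> Suc (Suc n)" "i \<le> Suc n" "j - 1 \<le> Suc n" using ij by auto
  show "bdry (quotient_trisp G T act) (Suc n) i
          (bdry (quotient_trisp G T act) (Suc (Suc n)) j X) =
        bdry (quotient_trisp G T act) (Suc n) (j - 1)
          (bdry (quotient_trisp G T act) (Suc (Suc n)) i X)"
    using x ij le bdry_bdry[OF T x(1), of i j] by (simp add: bdry_quotient bdry_in[OF T])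
qed

lemma vert_quotient:
  "x \<in> simps T n \<Longrightarrow>
   vert (quotient_trisp G T act) n (orbit G (act n) x) k = orbit G (act 0) (vert T n x k)"
  by (induction n arbitrary: x k) (auto simp: bdry_in[OF T] bdry_quotient)

lemma regular_quotient:
  assumes reg: "regular_trisp T" and R: "condition_R G T act"
  shows "regular_trisp (quotient_trisp G T act)"
  unfolding regular_trisp_def
proof (intro conjI allI ballI inj_onI)
  show "is_trisp (quotient_trisp G T act)" by (rule is_trisp_quotient)
next
  fix n X k l
  assume X: "X \<in> simps (quotient_trisp G T act) n" and kl: "k \<in> {..n}" "l \<in> {..n}"
    and eq: "vert (quotient_trisp G T act) n X k = vert (quotient_trisp G T act) n X l"
  then obtain x where x: "x \<in> simps T n" "X = orbit G (act n) x"
    by (auto simp: simps_quotient)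
  let ?v = "vert T n x"
  have act0: "group_action G (simps T 0) (act 0)" using A by (simp add: trisp_action_def)
  have v: "?v j \<in> simps T 0" for j using vert_in[OF T] x by blast
  have "?v l \<in> orbit G (act 0) (?v k)"
    using eq x group_action.orbit_refl[OF act0 v, of l] by (simp add: vert_quotient)
  then obtain g where g: "g \<in> carrier G" "?v l = act 0 g (?v k)" by (auto simp: orbit_def)
  have "is_face T (0, ?v l) (n, x)" using vert_is_face[OF T x(1)] kl by auto
  moreover have "is_face T (0, ?v l) (n, act n g x)"
    using g kl x vert_is_face[OF T act_in[OF g(1) x(1)], of k] by (simp add: act_vert)
  ultimately have "act 0 g (?v l) = ?v l"
    using R g(1) x v unfolding condition_R_def splx_def by fast
  then have "act 0 g (?v l) = act 0 g (?v k)" using g by simp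
  then have "?v l = ?v k"
    using group_action.inj_prop[OF act0 g(1)] v by (auto dest: inj_onD)
  then show "k = l" using reg x kl by (auto simp: regular_trisp_def dest: inj_onD)
qed

end

end

theory Submission
  imports Defs
begin

text \<open>
  Since a simplex of \<open>T\<close> is determined by its vertex set, every uniqueness clause about
  simplices of \<open>T\<close>, in Condition C as well as in the definition of a closure map on \<open>T\<close>,
  is automatic. In particular Condition C says no more than that each \<open>b \<in> B\<close> has exactly
  one candidate \<open>r\<^sub>b\<close>, which is one of the clauses of (2); so (2) implies (1).

  For the converse, let \<open>b\<close> be the minimal blue vertex of a simplex \<open>\<sigma>\<close>. Colours are
  constant on orbits and the projection to the quotient keeps the order of the vertices, so
  \<open>Gb\<close> is the minimal blue vertex of \<open>G\<sigma>\<close>, and \<open>\<psi>\<close> offers two cases. The key observation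
  (\<open>vertex_over_psi_eq_C_vertex\<close>) is that as soon as a simplex contains \<open>b\<close> and some
  \<open>r \<in> \<psi>(Gb)\<close>, it has a face with vertex set \<open>{b, r}\<close>, and Condition C forces \<open>r = r\<^sub>b\<close>.
  \<^item> If \<open>\<psi>(Gb)\<close> is a vertex of \<open>G\<sigma>\<close>, then \<open>\<sigma>\<close> has a vertex in \<open>\<psi>(Gb)\<close>, which must be \<open>r\<^sub>b\<close>;
    removing it from \<open>\<sigma>\<close> leaves a simplex, because \<open>b\<close> remains.
  \<^item> Otherwise \<open>G\<sigma>\<close> is a facet of a simplex of the quotient that contains \<open>\<psi>(Gb)\<close>. This
    simplex lifts to some \<open>\<tau>\<close> having \<open>\<sigma>\<close> itself as a facet (\<open>quotient_coface_lifts\<close>), and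
    the vertex of \<open>\<tau>\<close> over \<open>\<psi>(Gb)\<close> must again be \<open>r\<^sub>b\<close>.
\<close>

section \<open>Faces of regular trisps\<close>

lemma vset_iff: "v \<in> vset T (n, x) \<longleftrightarrow> (\<exists>k \<le> n. v = vert T n x k)"
  by (auto simp: vset_def)

lemma vset_bdry:
  assumes reg: "regular_trisp T" and x: "x \<in> simps T (Suc n)" and i: "i \<le> Suc n"
  shows "vset T (n, bdry T (Suc n) i x) = vset T (Suc n, x) - {vert T (Suc n) x i}"
proof -
  have T: "is_trisp T" and inj: "inj_on (vert T (Suc n) x) {..Suc n}"
    using reg x by (auto simp: regular_trisp_def)
  have indices: "(\<lambda>k. if k < i then k else Suc k) ` {..n} = {..Suc n} - {i}"
  proof (intro equalityI subsetI)
    fix j assume j: "j \<in> {..Suc n} - {i}"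
    show "j \<in> (\<lambda>k. if k < i then k else Suc k) ` {..n}"
    proof (cases "j < i")
      case True
      then show ?thesis using i by (intro image_eqI[of _ _ j]) auto
    next
      case False
      then show ?thesis using j by (intro image_eqI[of _ _ "j - 1"]) auto
    qed
  qed (use i in \<open>auto split: if_splits\<close>)
  have "vset T (n, bdry T (Suc n) i x) =
      vert T (Suc n) x ` (\<lambda>k. if k < i then k else Suc k) ` {..n}"
    unfolding vset_def image_image using vert_bdry[OF T x i] by (intro image_cong) auto
  also have "\<dots> = vert T (Suc n) x ` {..Suc n} - vert T (Suc n) x ` {i}"
    unfolding indices using i by (intro inj_on_image_set_diff[OF inj]) auto
  finally show ?thesis by (simp add: vset_def)
qed

text \<open>The vertices outside the given subset can be removed one at a time.\<close>

lemma face_with_vset: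
  assumes reg: "regular_trisp T" and "x \<in> simps T n" "A \<subseteq> vset T (n, x)" "A \<noteq> {}"
  shows "\<exists>t \<in> splx T. is_face T t (n, x) \<and> vset T t = A"
proof -
  have T: "is_trisp T" using reg by (simp add: regular_trisp_def)
  show ?thesis
    using assms(2-)
  proof (induction n arbitrary: x)
    case 0
    then have "vset T (0, x) = A" by (auto simp: vset_def)
    moreover have "(0, x) \<in> splx T" using 0 by (simp add: splx_def)
    ultimately show ?case by blast
  next
    case (Suc n)
    show ?case
    proof (cases "A = vset T (Suc n, x)")
      case True
      moreover have "(Suc n, x) \<in> splx T" using Suc.prems by (simp add: splx_def)
      ultimately show ?thesis by blast
    next
      case False
      then obtain v where v: "v \<in> vset T (Suc n, x)" "v \<notin> A" using Suc.prems by blast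
      then obtain i where i: "i \<le> Suc n" "vert T (Suc n) x i \<notin> A"
        unfolding vset_iff by blast
      let ?y = "bdry T (Suc n) i x"
      have "?y \<in> simps T n" by (rule bdry_in[OF T Suc.prems(1) i(1)])
      moreover have "A \<subseteq> vset T (n, ?y)"
        using Suc.prems(2) i vset_bdry[OF reg Suc.prems(1) i(1)] by blast
      ultimately obtain t where "t \<in> splx T" "is_face T t (n, ?y)" "vset T t = A"
        using Suc.IH Suc.prems by blast
      moreover have "is_facet T (n, ?y) (Suc n, x)"
        using i by (auto simp: is_facet_def)
      ultimately show ?thesis by (blast intro: rtranclp.rtrancl_into_rtrancl)
    qed
  qed
qed

lemma facet_without_vertex:
  assumes reg: "regular_trisp T" and x: "(n, x) \<in> splx T"
    and vw: "v \<in> vset T (n, x)" "w \<in> vset T (n, x)" "v \<noteq> w"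
  shows "\<exists>t \<in> splx T. is_facet T t (n, x) \<and> vset T t = vset T (n, x) - {v}"
proof -
  have T: "is_trisp T" using reg by (simp add: regular_trisp_def)
  obtain m where n: "n = Suc m" using vw by (cases n) (simp_all add: vset_iff)
  obtain i where i: "i \<le> n" "v = vert T n x i" using vw unfolding vset_iff by blast
  have x': "x \<in> simps T (Suc m)" using x n by (simp add: splx_def)
  have "(m, bdry T (Suc m) i x) \<in> splx T"
    using bdry_in[OF T x'] i n by (simp add: splx_def)
  moreover have "is_facet T (m, bdry T (Suc m) i x) (n, x)"
    using i n by (auto simp: is_facet_def)
  ultimately show ?thesis using vset_bdry[OF reg x'] i n by blast
qed

text \<open>
  The codimension leaves room for one new vertex only, so in a complex a coface is determined
  by its facet and that vertex.
\<close>

lemma vset_coface: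
  assumes reg: "regular_trisp T" and t: "t \<in> splx T" "is_facet T s t"
    and v: "v \<in> vset T t" "v \<notin> vset T s"
  shows "vset T t = insert v (vset T s)"
proof -
  obtain n x m y where st: "s = (n, x)" "t = (m, y)" by (metis surj_pair)
  then obtain i where i: "m = Suc n" "i \<le> Suc n" "x = bdry T (Suc n) i y"
    using t by (auto simp: is_facet_def)
  have "vset T s = vset T t - {vert T (Suc n) y i}"
    using vset_bdry[OF reg, of y n i] t st i by (simp add: splx_def)
  with v show ?thesis by blast
qed


section \<open>Lifting from the quotient\<close>

lemma vset_quotient:
  assumes "is_trisp T" "trisp_action G T act" "x \<in> simps T n"
  shows "vset (quotient_trisp G T act) (n, orbit G (act n) x) = orbit G (act 0) ` vset T (n, x)"
  using assms by (simp add: vset_def vert_quotient image_image)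

lemma (in group_action) orbit_of_member:
  assumes "X \<in> orbits G E \<phi>" "v \<in> X"
  shows "orbit G \<phi> v = X"
proof -
  have "v \<in> E" using assms orbits_coverture by blast
  then have "orbit G \<phi> v \<in> orbits G E \<phi>" "v \<in> orbit G \<phi> v"
    by (auto simp: orbits_def orbit_refl)
  with assms show ?thesis using disjoint_union by blast
qed

text \<open>
  Any representative of \<open>Y\<close> has a facet in the orbit of \<open>x\<close>; moving the representative by a
  suitable group element turns that facet into \<open>x\<close> itself.
\<close>

lemma quotient_coface_lifts:
  assumes T: "is_trisp T" and A: "trisp_action G T act" and x: "x \<in> simps T n"
    and Y: "(m, Y) \<in> splx (quotient_trisp G T act)"
    and facet: "is_facet (quotient_trisp G T act) (n, orbit G (act n) x) (m, Y)"
  shows "\<exists>y \<in> simps T m. Y = orbit G (act m) y \<and> is_facet T (n, x) (m, y)"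
proof -
  have act_n: "group_action G (simps T k) (act k)" for k
    using A by (simp add: trisp_action_def)
  obtain i where m: "m = Suc n" and i: "i \<le> Suc n"
    "orbit G (act n) x = bdry (quotient_trisp G T act) (Suc n) i Y"
    using facet by (auto simp: is_facet_def)
  obtain z where z: "z \<in> simps T (Suc n)" "Y = orbit G (act (Suc n)) z"
    using Y m by (auto simp: splx_def simps_quotient[OF T A])
  have "orbit G (act n) x = orbit G (act n) (bdry T (Suc n) i z)"
    using i z bdry_quotient[OF T A] by simp
  then have "x \<in> orbit G (act n) (bdry T (Suc n) i z)"
    using group_action.orbit_refl[OF act_n x] by simp
  then obtain g where g: "g \<in> carrier G" "x = act n g (bdry T (Suc n) i z)"
    by (auto simp: orbit_def)
  let ?y = "act (Suc n) g z"
  have y: "?y \<in> simps T (Suc n)" using act_in[OF T A] g z by blast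
  have "x = bdry T (Suc n) i ?y" using act_bdry[OF T A] g z i by simp
  then have "is_facet T (n, x) (Suc n, ?y)" using i by (auto simp: is_facet_def)
  moreover have "?y \<in> orbit G (act (Suc n)) z" using g by (auto simp: orbit_def)
  then have "Y = orbit G (act (Suc n)) ?y"
    using group_action.orbit_of_member[OF act_n, of Y "Suc n" ?y] z by (auto simp: orbits_def)
  ultimately show ?thesis using y m by blast
qed

lemma vertex_in_Union_orbits_iff:
  assumes A: "trisp_action G T act" and v: "v \<in> simps T 0"
    and \<X>: "\<X> \<subseteq> orbits G (simps T 0) (act 0)"
  shows "v \<in> \<Union>\<X> \<longleftrightarrow> orbit G (act 0) v \<in> \<X>"
proof -
  have act0: "group_action G (simps T 0) (act 0)" using A by (simp add: trisp_action_def)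
  have "orbit G (act 0) v = X" if "X \<in> \<X>" "v \<in> X" for X
    using group_action.orbit_of_member[OF act0] \<X> that by blast
  with group_action.orbit_refl[OF act0 v] show ?thesis by blast
qed

lemma min_blue_quotient:
  assumes T: "is_trisp T" and A: "trisp_action G T act" and x: "x \<in> simps T n"
    and \<X>: "\<X> \<subseteq> orbits G (simps T 0) (act 0)"
    and b: "min_blue T (\<Union>\<X>) (n, x) b"
  shows "min_blue (quotient_trisp G T act) \<X> (n, orbit G (act n) x) (orbit G (act 0) b)"
proof -
  have "vert T n x k \<in> \<Union>\<X> \<longleftrightarrow> vert (quotient_trisp G T act) n (orbit G (act n) x) k \<in> \<X>" for k
    using vertex_in_Union_orbits_iff[OF A vert_in[OF T x] \<X>] vert_quotient[OF T A x] by simp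
  with b show ?thesis
    unfolding min_blue_def fst_conv snd_conv by (metis vert_quotient[OF T A x])
qed


section \<open>Condition C and closure maps\<close>

text \<open>The simplex on \<open>{b, r\<^sub>b}\<close> exists by the choice of \<open>r\<^sub>b\<close> and is unique in a complex.\<close>

lemma condition_C_iff_unique_candidate:
  assumes cplx: "abstract_complex T"
  shows "condition_C G T act B \<psi> \<longleftrightarrow> (\<forall>b \<in> B. \<exists>!r. C_candidate G T act \<psi> b r)"
proof
  assume unique: "\<forall>b \<in> B. \<exists>!r. C_candidate G T act \<psi> b r"
  show "condition_C G T act B \<psi>"
    unfolding condition_C_def
  proof (intro ballI conjI)
    fix b assume "b \<in> B"
    with unique show ex1: "\<exists>!r. C_candidate G T act \<psi> b r" by blast
    then have "C_candidate G T act \<psi> b (C_vertex G T act \<psi> b)"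
      unfolding C_vertex_def by (rule theI')
    then show "\<exists>!s. s \<in> splx T \<and> vset T s = {b, C_vertex G T act \<psi> b}"
      using cplx unfolding C_candidate_def abstract_complex_def inj_on_def by metis
  qed
qed (simp add: condition_C_def)

lemma vertex_over_psi_eq_C_vertex:
  assumes reg: "regular_trisp T" and s: "s \<in> splx T"
    and br: "b \<in> vset T s" "r \<in> vset T s" "r \<in> \<psi> (orbit G (act 0) b)"
    and unique: "\<exists>!r. C_candidate G T act \<psi> b r"
  shows "r = C_vertex G T act \<psi> b"
proof -
  obtain n x where "s = (n, x)" by (cases s)
  then have "\<exists>t \<in> splx T. vset T t = {b, r}"
    using face_with_vset[OF reg, of x n "{b, r}"] s br by (auto simp: splx_def)
  then have "C_candidate G T act \<psi> b r" using br by (simp add: C_candidate_def)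
  then show ?thesis unfolding C_vertex_def using unique by (rule the1_equality[symmetric, rotated])
qed

lemma closure_map_coface:
  assumes "trisp_closure_map T B R \<phi>" "s \<in> splx T" "min_blue T B s b" "\<phi> b \<notin> vset T s"
  shows "\<exists>t \<in> splx T. \<phi> b \<in> vset T t \<and> is_facet T s t"
proof -
  have "(\<phi> b \<in> vset T s \<and>
          (\<exists>!t. t \<in> splx T \<and> is_facet T t s \<and> vset T t = vset T s - {\<phi> b})) \<or>
        (\<phi> b \<notin> vset T s \<and>
          (\<exists>!t. t \<in> splx T \<and> \<phi> b \<in> vset T t \<and> is_facet T s t))"
    using assms(1-3) by (simp only: trisp_closure_map_def)
  with assms(4) show ?thesis by blast
qed

theorem proposition10:
  fixes G :: "('g, 'm) monoid_scheme"
    and T :: "'a trisp"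
    and act :: "nat \<Rightarrow> 'g \<Rightarrow> 'a \<Rightarrow> 'a"
    and Bbar Rbar :: "'a set set"
    and \<psi> :: "'a set \<Rightarrow> 'a set"
    and B R :: "'a set"
    and \<phi> :: "'a \<Rightarrow> 'a"
  assumes "group G" and "finite (carrier G)"
    and "regular_trisp T" and "abstract_complex T"
    and "trisp_action G T act" and "condition_R G T act"
    and "trisp_closure_map (quotient_trisp G T act) Bbar Rbar \<psi>"
  defines "B \<equiv> \<Union>Bbar" and "R \<equiv> \<Union>Rbar"
    and "\<phi> \<equiv> C_vertex G T act \<psi>"
  shows "condition_C G T act B \<psi> \<longleftrightarrow>
    (\<forall>b \<in> B. \<exists>!r. C_candidate G T act \<psi> b r) \<and>
    trisp_closure_map T B R \<phi> \<and>
    (\<forall>b \<in> B. orbit G (act 0) (\<phi> b) = \<psi> (orbit G (act 0) b))"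
proof -
  note reg = assms(3) and A = assms(5) and closure = assms(7)
  let ?Q = "quotient_trisp G T act" and ?orb = "orbit G (act 0)"
  have T: "is_trisp T" using reg by (simp add: regular_trisp_def)
  have act0: "group_action G (simps T 0) (act 0)" using A by (simp add: trisp_action_def)
  have cplx: "s = t" if "s \<in> splx T" "t \<in> splx T" "vset T s = vset T t" for s t
    using assms(4) that by (auto simp: abstract_complex_def dest: inj_onD)
  have quotient_vertices: "simps ?Q 0 = orbits G (simps T 0) (act 0)"
    by (simp add: quotient_trisp_def)
  have colours: "Bbar \<union> Rbar = orbits G (simps T 0) (act 0)" "Bbar \<inter> Rbar = {}"
    and \<psi>: "\<psi> \<in> Bbar \<rightarrow> Rbar"
    using closure by (simp_all only: trisp_closure_map_def quotient_vertices)
  have sub: "Bbar \<subseteq> orbits G (simps T 0) (act 0)" "Rbar \<subseteq> orbits G (simps T 0) (act 0)"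
    using colours by auto
  have blue: "v \<in> B \<longleftrightarrow> ?orb v \<in> Bbar" and red: "v \<in> R \<longleftrightarrow> ?orb v \<in> Rbar"
    if "v \<in> simps T 0" for v
    unfolding B_def R_def using vertex_in_Union_orbits_iff[OF A that] sub by auto
  have vertices: "B \<subseteq> simps T 0" "R \<subseteq> simps T 0"
    using sub group_action.orbits_coverture[OF act0] unfolding B_def R_def by blast+
  have orb_eq: "?orb r = X" if "r \<in> X" "X \<in> Rbar" for r X
    using group_action.orbit_of_member[OF act0] that sub(2) by blast
  have partition: "B \<union> R = simps T 0" "B \<inter> R = {}"
  proof -
    have "v \<in> B \<union> R" if "v \<in> simps T 0" for v
      using that colours blue[OF that] red[OF that] by (auto simp: orbits_def)
    then show "B \<union> R = simps T 0" using vertices by blast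
    show "B \<inter> R = {}" using colours blue red vertices by blast
  qed
  have "trisp_closure_map T B R \<phi> \<and> (\<forall>b \<in> B. ?orb (\<phi> b) = \<psi> (?orb b))"
    if unique: "\<forall>b \<in> B. \<exists>!r. C_candidate G T act \<psi> b r"
  proof -
    have cand: "\<phi> b \<in> \<psi> (?orb b)" if "b \<in> B" for b
      using theI'[OF unique[rule_format, OF that]]
      by (simp add: \<phi>_def C_vertex_def C_candidate_def)
    have \<psi>_red: "\<psi> (?orb b) \<in> Rbar" if "b \<in> B" for b
      using funcset_mem[OF \<psi>] blue that vertices by blast
    have orb_\<phi>: "?orb (\<phi> b) = \<psi> (?orb b)" if "b \<in> B" for b
      using orb_eq[OF cand \<psi>_red] that by blast
    have \<phi>_red: "\<phi> \<in> B \<rightarrow> R"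
      using cand \<psi>_red unfolding R_def by blast
    \<comment> \<open>Condition C identifies every vertex over \<open>\<psi>(Gb)\<close> that shares a simplex with \<open>b\<close>.\<close>
    have over_\<psi>: "\<phi> b \<in> vset T (n, x)"
      if b: "b \<in> B" "b \<in> vset T (n, x)" and x: "x \<in> simps T n"
        and \<psi>b: "\<psi> (?orb b) \<in> vset ?Q (n, orbit G (act n) x)" for n x b
    proof -
      obtain r where r: "r \<in> vset T (n, x)" "?orb r = \<psi> (?orb b)"
        using \<psi>b unfolding vset_quotient[OF T A x] by force
      have "r \<in> simps T 0" using r(1) vert_in[OF T x] unfolding vset_iff by blast
      then have "r \<in> \<psi> (?orb b)" using r group_action.orbit_refl[OF act0] by metis
      then have "r = \<phi> b"
        unfolding \<phi>_def using b r x unique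
        by (intro vertex_over_psi_eq_C_vertex[OF reg, of "(n, x)"]) (auto simp: splx_def)
      with r show ?thesis by simp
    qed
    have closes: "(\<phi> b \<in> vset T s \<and>
            (\<exists>!t. t \<in> splx T \<and> is_facet T t s \<and> vset T t = vset T s - {\<phi> b})) \<or>
          (\<phi> b \<notin> vset T s \<and>
            (\<exists>!t. t \<in> splx T \<and> \<phi> b \<in> vset T t \<and> is_facet T s t))"
      if s: "s \<in> splx T" and minb: "min_blue T B s b" for s b
    proof -
      obtain n x where nx: "s = (n, x)" by (cases s)
      have x: "x \<in> simps T n" using s nx by (simp add: splx_def)
      have b: "b \<in> B" "b \<in> vset T (n, x)"
        using minb unfolding nx min_blue_def vset_iff fst_conv snd_conv by blast+
      have \<phi>_ne: "\<phi> b \<noteq> b" using funcset_mem[OF \<phi>_red b(1)] b(1) partition(2) by (metis disjoint_iff)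
      let ?X = "(n, orbit G (act n) x)"
      have "?X \<in> splx ?Q" using x by (simp add: splx_def simps_quotient[OF T A])
      moreover have "min_blue ?Q Bbar ?X (?orb b)"
        using min_blue_quotient[OF T A x sub(1)] minb nx by (simp add: B_def)
      ultimately have coface: "\<exists>Y \<in> splx ?Q. \<psi> (?orb b) \<in> vset ?Q Y \<and> is_facet ?Q ?X Y"
        if "\<psi> (?orb b) \<notin> vset ?Q ?X"
        using closure_map_coface[OF closure _ _ that] by blast
      show ?thesis
      proof (cases "\<psi> (?orb b) \<in> vset ?Q ?X")
        case True
        then have mem: "\<phi> b \<in> vset T s" using over_\<psi> b x nx by blast
        then have "\<exists>t \<in> splx T. is_facet T t s \<and> vset T t = vset T s - {\<phi> b}"
          using facet_without_vertex[OF reg s[unfolded nx] mem[unfolded nx] b(2) \<phi>_ne]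
          unfolding nx by blast
        then have "\<exists>!t. t \<in> splx T \<and> is_facet T t s \<and> vset T t = vset T s - {\<phi> b}"
          using cplx by metis
        with mem show ?thesis by blast
      next
        case False
        \<comment> \<open>\<open>\<phi>(b)\<close> projects to \<open>\<psi>(Gb)\<close>.\<close>
        have notmem: "\<phi> b \<notin> vset T s"
        proof
          assume "\<phi> b \<in> vset T s"
          then have "?orb (\<phi> b) \<in> vset ?Q ?X"
            unfolding nx vset_quotient[OF T A x] by (rule imageI)
          with False orb_\<phi>[OF b(1)] show False by simp
        qed
        obtain m Y where Y: "(m, Y) \<in> splx ?Q" "\<psi> (?orb b) \<in> vset ?Q (m, Y)"
            "is_facet ?Q ?X (m, Y)"
          using coface[OF False] by (metis surj_pair)
        obtain y where y: "y \<in> simps T m" "Y = orbit G (act m) y" "is_facet T s (m, y)"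
          using quotient_coface_lifts[OF T A x Y(1,3)] nx by blast
        have "vset T s \<subseteq> vset T (m, y)"
        proof -
          obtain i where i: "m = Suc n" "i \<le> Suc n" "x = bdry T (Suc n) i y"
            using y(3) nx by (auto simp: is_facet_def)
          then show ?thesis using vset_bdry[OF reg, of y n i] y(1) nx by auto
        qed
        then have "\<phi> b \<in> vset T (m, y)"
          using over_\<psi>[OF b(1) _ y(1)] b(2) Y(2) unfolding nx y(2) by blast
        then have "\<exists>t. t \<in> splx T \<and> \<phi> b \<in> vset T t \<and> is_facet T s t"
          using y by (auto simp: splx_def)
        moreover have "t = t'"
          if "t \<in> splx T \<and> \<phi> b \<in> vset T t \<and> is_facet T s t"
            "t' \<in> splx T \<and> \<phi> b \<in> vset T t' \<and> is_facet T s t'" for t t'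
          using that cplx vset_coface[OF reg _ _ _ notmem] by metis
        ultimately show ?thesis using notmem by blast
      qed
    qed
    have "trisp_closure_map T B R \<phi>"
      unfolding trisp_closure_map_def
      by (intro conjI ballI allI impI reg partition \<phi>_red) (rule closes)
    with orb_\<phi> show ?thesis by blast
  qed
  then show ?thesis
    unfolding condition_C_iff_unique_candidate[OF assms(4)] by argo
qed

end
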